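(* Let $\Omega\subset\mathbb{R}^n$ be locally closed and strictly smooth at $\bar z\in\Omega$. Then $\Omega$ is a Lipschitz manifold of dimension $d$ around $\bar z$, where $d$ is the dimension of the subspace $T_\Omega(\bar z)$. Moreover, there are an $n\times n$ permutation matrix $\tilde Q$ and an open neighborhood $V\times U\subset\mathbb{R}^d\times\mathbb{R}^{n-d}$ of $\tilde Q\bar z=:(\bar y,\bar x)\in\mathbb{R}^d\times\mathbb{R}^{n-d}$ such that $\tilde Q\Omega\cap(V\times U)$ is the graph of a Lipschitzian mapping $f:V\to\mathbb{R}^{n-d}$ which is strictly differentiable at $\bar y$.
   Context: Set limits are in the Painlevé–Kuratowski sense: for a family $C_t$ of sets, $\limsup_{t\to\bar t}C_t=\{x\mid\liminf_{t\to\bar t}\mathrm{dist}(x,C_t)=0\}$ and $\liminf_{t\to\bar t}C_t=\{x\mid\limsup_{t\to\bar t}\mathrm{dist}(x,C_t)=0\}$; the limit exists if both coincide. For $\Omega\subset\mathbb{R}^n$ and $\bar z\in\Omega$: - tangent cone: $T_\Omega(\bar z)=\limsup_{t\downarrow0}\frac{\Omega-\bar z}{t}$; - regular (Clarke) tangent cone: $\widehat T_\Omega(\bar z)=\liminf_{z\to\bar z,\,z\in\Omega,\,t\downarrow0}\frac{\Omega-z}{t}$; - paratingent cone: $T^P_\Omega(\bar z)=\limsup_{z\to\bar z,\,z\in\Omega,\,t\downarrow0}\frac{\Omega-z}{t}$. $\Omega$ is strictly smooth at $\bar z$ if $\lim_{z\to\bar z,\,z\in\Omega,\,t\downarrow0}\frac{\Omega-z}{t}$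 exists, i.e. $\widehat T_\Omega(\bar z)=T^P_\Omega(\bar z)$; in this case $\widehat T_\Omega(\bar z)=T_\Omega(\bar z)=T_\Omega^P(\bar z)$ is a subspace. $\Omega$ is a Lipschitz manifold of dimension $d$ around $\bar z\in\Omega$ ($0\le d\le n$, $\mathbb{R}^0=\{0\}$) if there is an open neighborhood $W$ of $\bar z$ and a one-to-one mapping $\Phi$ from $W$ onto an open subset of $\mathbb{R}^n$, with $\Phi$ and $\Phi^{-1}$ continuously differentiable, such that $\Phi(\Omega\cap W)$ is the graph of a Lipschitz continuous mapping $g:U'\to\mathbb{R}^{n-d}$, where $U'$ is an open set in $\mathbb{R}^d$. A mapping $f$ from an open subset of $\mathbb{R}^d$ to $\mathbb{R}^k$ is strictly differentiable at $\bar y$ if there is a $k\times d$ matrix $A$ with $\lim_{y,y'\to\bar y,\,y\ne y'}\frac{f(y')-f(y)-A(y'-y)}{\|y'-y\|}=0$. *)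

theory Defs
  imports "HOL-Analysis.Analysis"
begin

section \<open>Painleve--Kuratowski set limits\<close>

text \<open>Extended-real valued, so that the distance to the empty set is \<open>\<infinity>\<close>
  (the library's \<^const>\<open>infdist\<close> would give 0).\<close>

definition set_dist :: "'a::metric_space \<Rightarrow> 'a set \<Rightarrow> ereal" where
  "set_dist x C = (INF c\<in>C. ereal (dist x c))"

definition PK_limsup :: "'i filter \<Rightarrow> ('i \<Rightarrow> 'a::metric_space set) \<Rightarrow> 'a set" where
  "PK_limsup F C = {x. Liminf F (\<lambda>t. set_dist x (C t)) = 0}"

definition PK_liminf :: "'i filter \<Rightarrow> ('i \<Rightarrow> 'a::metric_space set) \<Rightarrow> 'a set" where
  "PK_liminf F C = {x. Limsup F (\<lambda>t. set_dist x (C t)) = 0}"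


section \<open>Tangent cones and strict smoothness\<close>

definition rescaled :: "'a::real_normed_vector set \<Rightarrow> 'a \<Rightarrow> real \<Rightarrow> 'a set" where
  "rescaled \<Omega> z t = (\<lambda>w. (w - z) /\<^sub>R t) ` \<Omega>"

text \<open>The filter of \<open>z \<rightarrow> zbar, z \<in> \<Omega>, t \<down> 0\<close>. The base point may equal
  \<open>zbar\<close>, hence \<open>inf (nhds zbar) (principal \<Omega>)\<close> rather than the punctured
  \<open>at zbar within \<Omega>\<close>.\<close>

definition base_filter :: "'a::real_normed_vector set \<Rightarrow> 'a \<Rightarrow> ('a \<times> real) filter" where
  "base_filter \<Omega> zbar = inf (nhds zbar) (principal \<Omega>) \<times>\<^sub>F at_right 0"

definition tangent_cone :: "'a::real_normed_vector set \<Rightarrow> 'a \<Rightarrow> 'a set" where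
  "tangent_cone \<Omega> zbar = PK_limsup (at_right 0) (\<lambda>t. rescaled \<Omega> zbar t)"

definition regular_tangent_cone :: "'a::real_normed_vector set \<Rightarrow> 'a \<Rightarrow> 'a set" where
  "regular_tangent_cone \<Omega> zbar =
     PK_liminf (base_filter \<Omega> zbar) (\<lambda>(z, t). rescaled \<Omega> z t)"

definition paratingent_cone :: "'a::real_normed_vector set \<Rightarrow> 'a \<Rightarrow> 'a set" where
  "paratingent_cone \<Omega> zbar =
     PK_limsup (base_filter \<Omega> zbar) (\<lambda>(z, t). rescaled \<Omega> z t)"

definition strictly_smooth_at :: "'a::real_normed_vector set \<Rightarrow> 'a \<Rightarrow> bool" where
  "strictly_smooth_at \<Omega> zbar \<longleftrightarrow> regular_tangent_cone \<Omega> zbar = paratingent_cone \<Omega> zbar"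

definition locally_closed_at :: "'a::topological_space set \<Rightarrow> 'a \<Rightarrow> bool" where
  "locally_closed_at \<Omega> zbar \<longleftrightarrow>
     (\<exists>N. closed N \<and> zbar \<in> interior N \<and> closed (\<Omega> \<inter> N))"


text \<open>Same type as \<open>real ^ 'n\<close>, whose notation would force the sort of \<open>'n\<close> to be
  repeated at each occurrence.\<close>

type_synonym 'n rvec = "(real, 'n) vec"


section \<open>The splitting of n-space into its first d and last n - d coordinates\<close>

text \<open>The dimension \<open>d\<close> depends on the data and may be 0 or \<open>n\<close>, so it cannot be an
  index type. The coordinates of \<open>real ^ 'n\<close> are ordered by the linear order of \<open>'n\<close>;
  d-space and (n-d)-space are the subspaces of vectors supported on the first \<open>d\<close>,
  respectively the last \<open>n - d\<close>, coordinates. Their norms and topologies are the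
  Euclidean ones, and \<open>split_coords d\<close> is the identification of n-space with
  the product.\<close>

definition coord_rank :: "'n::{finite,linorder} \<Rightarrow> nat" where
  "coord_rank i = card {j. j < i}"

definition first_space :: "nat \<Rightarrow> ('n::{finite,linorder}) rvec set" where
  "first_space d = {v. \<forall>i. d \<le> coord_rank i \<longrightarrow> v $ i = 0}"

definition last_space :: "nat \<Rightarrow> ('n::{finite,linorder}) rvec set" where
  "last_space d = {v. \<forall>i. coord_rank i < d \<longrightarrow> v $ i = 0}"

definition split_coords ::
    "nat \<Rightarrow> ('n::{finite,linorder}) rvec \<Rightarrow> 'n rvec \<times> 'n rvec" where
  "split_coords d z =
     (\<chi> i. if coord_rank i < d then z $ i else 0, \<chi> i. if coord_rank i < d then 0 else z $ i)"

definition graph_on :: "'a set \<Rightarrow> ('a \<Rightarrow> 'b) \<Rightarrow> ('a \<times> 'b) set" where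
  "graph_on V f = {(y, f y) | y. y \<in> V}"


section \<open>Lipschitz manifolds\<close>

definition C1_on :: "('a::real_normed_vector \<Rightarrow> 'b::real_normed_vector) \<Rightarrow> 'a set \<Rightarrow> bool" where
  "C1_on \<Phi> W \<longleftrightarrow>
     (\<exists>D :: 'a \<Rightarrow> 'a \<Rightarrow>\<^sub>L 'b.
        (\<forall>x\<in>W. (\<Phi> has_derivative blinfun_apply (D x)) (at x)) \<and> continuous_on W D)"

definition lipschitz_manifold_around ::
    "('n::{finite,linorder}) rvec set \<Rightarrow> nat \<Rightarrow> 'n rvec \<Rightarrow> bool" where
  "lipschitz_manifold_around \<Omega> d zbar \<longleftrightarrow>
     zbar \<in> \<Omega> \<and> d \<le> CARD('n) \<and>
     (\<exists>(W :: 'n rvec set) (\<Phi> :: 'n rvec \<Rightarrow> 'n rvec)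
        (U' :: 'n rvec set) (g :: 'n rvec \<Rightarrow> 'n rvec) L.
        open W \<and> zbar \<in> W \<and> inj_on \<Phi> W \<and> open (\<Phi> ` W) \<and>
        C1_on \<Phi> W \<and> C1_on (inv_into W \<Phi>) (\<Phi> ` W) \<and>
        openin (top_of_set (first_space d)) U' \<and>
        g ` U' \<subseteq> last_space d \<and> L-lipschitz_on U' g \<and>
        split_coords d ` (\<Phi> ` (\<Omega> \<inter> W)) = graph_on U' g)"


section \<open>Strict differentiability and permutation matrices\<close>

text \<open>Here \<open>f\<close> maps the set \<open>V\<close>, open in d-space, to (n-d)-space; the
  (n-d) x d matrix is the corresponding block of an n x n matrix that vanishes elsewhere.\<close>

definition strictly_differentiable_at ::
    "nat \<Rightarrow> ('n::{finite,linorder}) rvec set \<Rightarrow> ('n rvec \<Rightarrow> 'n rvec) \<Rightarrow> 'n rvec \<Rightarrow> bool" where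
  "strictly_differentiable_at d V f ybar \<longleftrightarrow>
     (\<exists>A :: ('n rvec, 'n) vec.
        (\<forall>i j. A $ i $ j \<noteq> 0 \<longrightarrow> d \<le> coord_rank i \<and> coord_rank j < d) \<and>
        ((\<lambda>(y, y'). (f y' - f y - A *v (y' - y)) /\<^sub>R norm (y' - y)) \<longlongrightarrow> 0)
          (at (ybar, ybar) within {(y, y'). y \<in> V \<and> y' \<in> V \<and> y \<noteq> y'}))"

definition permutation_matrix :: "(('n::finite) rvec, 'n) vec \<Rightarrow> bool" where
  "permutation_matrix Q \<longleftrightarrow>
     (\<exists>p. p permutes UNIV \<and> Q = (\<chi> i j. if j = p i then 1 else 0))"

end

theory Submission
  imports Defs
begin

text \<open>
  Let \<open>S\<close> be the common value of the regular, tangent and paratingent cones of \<open>\<Omega>\<close> at \<open>zbar\<close>.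
  It is a subspace because the regular cone is convex and the paratingent cone is symmetric
  (\<open>subspace_regular_tangent_cone\<close>). Some \<open>d = dim S\<close> coordinates determine the vectors of \<open>S\<close>
  (\<open>subspace_determined_by_coordinates\<close>). After a permutation that puts them first, \<open>S\<close> is the
  graph of a linear map over d-space. Let \<open>\<pi>\<close> and \<open>\<psi>\<close> denote the first \<open>d\<close> and the
  remaining permuted coordinates, and let \<open>\<sigma>\<close> lift d-space to \<open>S\<close>, inverse to \<open>\<pi>\<close>.

  The two cones then play complementary roles. That no vector outside \<open>S\<close> is paratingent
  bounds the secants of \<open>\<Omega>\<close>: for each \<open>\<epsilon>\<close>, the secants \<open>u\<close> between points near \<open>zbar\<close>
  satisfy \<open>norm (u - \<sigma> (\<pi> u)) \<le> \<epsilon> * norm (\<pi> u)\<close> (\<open>secants_near_tangent_space\<close>). Hence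
  \<open>\<Omega>\<close> is locally the graph of a Lipschitz map over its projection, strictly differentiable
  with derivative \<open>\<psi> \<circ> \<sigma>\<close>. That all vectors of \<open>S\<close> are regular tangents shows that this
  projection fills a neighbourhood (\<open>projection_open_at\<close>): from a point of \<open>\<Omega>\<close> whose
  projection is nearest to a missed target one could step closer to it along \<open>S\<close>. Local closedness is
  what provides the nearest point. Both statements need uniformity in the direction,
  which follows from compactness of the unit sphere.

  The permutation itself serves as the chart that makes \<open>\<Omega>\<close> a Lipschitz manifold.
\<close>

section \<open>The tangent cones without extended distances\<close>

text \<open>The rescaled set \<open>(\<Omega> - z) / t\<close> comes within \<open>\<epsilon>\<close> of \<open>v\<close>, multiplied out so that no
division remains. The pair argument is that of \<^const>\<open>base_filter\<close>.\<close>

definition step_near :: "'a::real_normed_vector set \<Rightarrow> 'a \<Rightarrow> real \<Rightarrow> 'a \<times> real \<Rightarrow> bool" where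
  "step_near \<Omega> v \<epsilon> = (\<lambda>(z, t). \<exists>w\<in>\<Omega>. norm (w - z - t *\<^sub>R v) < \<epsilon> * t)"

lemma eventually_base_filter:
  "eventually P (base_filter \<Omega> zbar) \<longleftrightarrow>
     (\<exists>\<delta>>0. \<forall>z\<in>\<Omega>. \<forall>t. dist z zbar < \<delta> \<and> 0 < t \<and> t < \<delta> \<longrightarrow> P (z, t))"
  (is "?L \<longleftrightarrow> ?R")
proof
  assume ?L
  then obtain Pf Pg where Pf: "\<forall>\<^sub>F z in inf (nhds zbar) (principal \<Omega>). Pf z"
    and Pg: "\<forall>\<^sub>F t in at_right 0. Pg t" and P: "\<And>x y. Pf x \<Longrightarrow> Pg y \<Longrightarrow> P (x, y)"
    unfolding base_filter_def eventually_prod_filter by blast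
  from Pf obtain a where "a > 0" "\<And>z. dist z zbar < a \<Longrightarrow> z \<in> \<Omega> \<Longrightarrow> Pf z"
    by (auto simp: eventually_inf_principal eventually_nhds_metric)
  moreover from Pg obtain b :: real where "b > 0" "\<And>t. 0 < t \<Longrightarrow> t < b \<Longrightarrow> Pg t"
    by (auto simp: eventually_at_right_field)
  ultimately show ?R
    by (intro exI[of _ "min a b"]) (auto intro!: P)
next
  assume ?R
  then obtain d where d: "d > 0" "\<And>z t. z \<in> \<Omega> \<Longrightarrow> dist z zbar < d \<Longrightarrow> 0 < t \<Longrightarrow> t < d \<Longrightarrow> P (z, t)"
    by blast
  have "\<forall>\<^sub>F z in inf (nhds zbar) (principal \<Omega>). z \<in> \<Omega> \<and> dist z zbar < d"
    using d(1) by (auto simp: eventually_inf_principal eventually_nhds_metric)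
  moreover have "\<forall>\<^sub>F t in at_right 0. 0 < t \<and> t < d"
    using d(1) by (auto simp: eventually_at_right_field)
  ultimately show ?L
    unfolding base_filter_def eventually_prod_filter using d(2) by blast
qed

lemma frequently_base_filter:
  "frequently P (base_filter \<Omega> zbar) \<longleftrightarrow>
     (\<forall>\<delta>>0. \<exists>z\<in>\<Omega>. \<exists>t. dist z zbar < \<delta> \<and> 0 < t \<and> t < \<delta> \<and> P (z, t))"
  unfolding frequently_def eventually_base_filter by auto

lemma set_dist_nonneg: "0 \<le> set_dist x C"
  unfolding set_dist_def by (rule INF_greatest) simp

lemma set_dist_rescaled_less_iff:
  assumes "0 < t"
  shows "set_dist v (rescaled \<Omega> z t) < ereal \<epsilon> \<longleftrightarrow> step_near \<Omega> v \<epsilon> (z, t)"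
proof -
  have "dist v ((w - z) /\<^sub>R t) < \<epsilon> \<longleftrightarrow> norm (w - z - t *\<^sub>R v) < \<epsilon> * t" for w
  proof -
    have "w - z - t *\<^sub>R v = (- t) *\<^sub>R (v - (w - z) /\<^sub>R t)"
      using assms by (simp add: algebra_simps)
    then have "norm (w - z - t *\<^sub>R v) = t * dist v ((w - z) /\<^sub>R t)"
      using assms by (metis abs_minus_cancel abs_of_pos dist_norm norm_scaleR)
    then show ?thesis using assms by (simp add: mult.commute)
  qed
  then show ?thesis
    by (auto simp: set_dist_def rescaled_def step_near_def INF_less_iff)
qed

text \<open>A trivial filter would make the upper limit of the distances \<open>-\<infinity>\<close>, not 0.\<close>

lemma mem_PK_liminf_iff:
  assumes "F \<noteq> bot"
  shows "x \<in> PK_liminf F C \<longleftrightarrow> (\<forall>\<epsilon>>0. \<forall>\<^sub>F t in F. set_dist x (C t) < ereal \<epsilon>)"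
proof -
  have "0 \<le> Limsup F (\<lambda>t. set_dist x (C t))"
    by (rule le_Limsup[OF assms]) (simp add: set_dist_nonneg)
  then have "x \<in> PK_liminf F C \<longleftrightarrow> Limsup F (\<lambda>t. set_dist x (C t)) \<le> 0"
    unfolding PK_liminf_def by auto
  also have "\<dots> \<longleftrightarrow> (\<forall>y>0. \<forall>\<^sub>F t in F. set_dist x (C t) < y)"
    by (rule Limsup_le_iff)
  also have "\<dots> \<longleftrightarrow> (\<forall>\<epsilon>>0. \<forall>\<^sub>F t in F. set_dist x (C t) < ereal \<epsilon>)"
  proof (intro iffI allI impI)
    fix y :: ereal assume *: "\<forall>\<epsilon>>0. \<forall>\<^sub>F t in F. set_dist x (C t) < ereal \<epsilon>" and "0 < y"
    then obtain e where e: "0 < ereal e" "ereal e < y" using ereal_dense2 by blast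
    then have "\<forall>\<^sub>F t in F. set_dist x (C t) < ereal e" using * by simp
    then show "\<forall>\<^sub>F t in F. set_dist x (C t) < y"
      by (rule eventually_mono) (use e(2) in auto)
  qed simp
  finally show ?thesis .
qed

lemma mem_PK_limsup_iff:
  "x \<in> PK_limsup F C \<longleftrightarrow> (\<forall>\<epsilon>>0. \<exists>\<^sub>F t in F. set_dist x (C t) < ereal \<epsilon>)"
proof -
  let ?g = "\<lambda>t. set_dist x (C t)"
  have "0 \<le> Liminf F ?g"
    by (rule Liminf_bounded) (simp add: set_dist_nonneg)
  then have "x \<in> PK_limsup F C \<longleftrightarrow> \<not> 0 < Liminf F ?g"
    unfolding PK_limsup_def by auto
  also have "0 < Liminf F ?g \<longleftrightarrow> (\<exists>\<epsilon>>0. \<forall>\<^sub>F t in F. ereal \<epsilon> \<le> ?g t)"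
  proof
    assume "0 < Liminf F ?g"
    then obtain e where e: "0 < ereal e" "ereal e < Liminf F ?g" using ereal_dense2 by blast
    from less_LiminfD[OF e(2)] have "\<forall>\<^sub>F t in F. ereal e \<le> ?g t"
      by (rule eventually_mono) auto
    then show "\<exists>\<epsilon>>0. \<forall>\<^sub>F t in F. ereal \<epsilon> \<le> ?g t" using e(1) by auto
  next
    assume "\<exists>\<epsilon>>0. \<forall>\<^sub>F t in F. ereal \<epsilon> \<le> ?g t"
    then obtain e where "e > 0" "\<forall>\<^sub>F t in F. ereal e \<le> ?g t" by blast
    then show "0 < Liminf F ?g" using Liminf_bounded[of "ereal e" ?g F]
      by (metis ereal_less(2) less_le_trans)
  qed
  finally show ?thesis unfolding frequently_def not_less by blast
qed

lemma base_filter_neq_bot: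
  assumes "zbar \<in> \<Omega>"
  shows "base_filter \<Omega> zbar \<noteq> bot"
  unfolding trivial_limit_def eventually_base_filter
proof safe
  fix \<delta> :: real
  assume "\<delta> > 0" "\<forall>z\<in>\<Omega>. \<forall>t. dist z zbar < \<delta> \<and> 0 < t \<and> t < \<delta> \<longrightarrow> False"
  then show False using assms dense[of 0 \<delta>] by auto
qed

lemma eventually_base_filter_pos: "\<forall>\<^sub>F (z, t) in base_filter \<Omega> zbar. 0 < t"
  unfolding eventually_base_filter by (auto intro: exI[of _ 1])

text \<open>The three cones differ only in the quantifier: the regular one asks for an approximate step
at all base points and scales near the limit, the paratingent one for arbitrarily late ones,
and the tangent cone for arbitrarily small steps from \<open>zbar\<close> itself.\<close>

lemma mem_regular_tangent_cone_iff:
  assumes "zbar \<in> \<Omega>"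
  shows "v \<in> regular_tangent_cone \<Omega> zbar \<longleftrightarrow>
    (\<forall>\<epsilon>>0. eventually (step_near \<Omega> v \<epsilon>) (base_filter \<Omega> zbar))"
proof -
  have "(\<forall>\<^sub>F x in base_filter \<Omega> zbar. set_dist v (case x of (z, t) \<Rightarrow> rescaled \<Omega> z t) < ereal \<epsilon>)
      \<longleftrightarrow> eventually (step_near \<Omega> v \<epsilon>) (base_filter \<Omega> zbar)" for \<epsilon>
    by (rule eventually_cong[OF eventually_base_filter_pos])
       (auto simp: set_dist_rescaled_less_iff)
  then show ?thesis
    unfolding regular_tangent_cone_def mem_PK_liminf_iff[OF base_filter_neq_bot[OF assms]] by simp
qed

lemma mem_paratingent_cone_iff:
  "v \<in> paratingent_cone \<Omega> zbar \<longleftrightarrow>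
    (\<forall>\<epsilon>>0. frequently (step_near \<Omega> v \<epsilon>) (base_filter \<Omega> zbar))"
proof -
  have "(\<exists>\<^sub>F x in base_filter \<Omega> zbar. set_dist v (case x of (z, t) \<Rightarrow> rescaled \<Omega> z t) < ereal \<epsilon>)
      \<longleftrightarrow> frequently (step_near \<Omega> v \<epsilon>) (base_filter \<Omega> zbar)" for \<epsilon>
    by (rule frequently_cong[OF eventually_base_filter_pos])
       (auto simp: set_dist_rescaled_less_iff)
  then show ?thesis
    unfolding paratingent_cone_def mem_PK_limsup_iff by simp
qed

lemma mem_tangent_cone_iff:
  "v \<in> tangent_cone \<Omega> zbar \<longleftrightarrow>
    (\<forall>\<epsilon>>0. \<exists>\<^sub>F t in at_right 0. step_near \<Omega> v \<epsilon> (zbar, t))"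
proof -
  have "(\<exists>\<^sub>F t in at_right 0. set_dist v (rescaled \<Omega> zbar t) < ereal \<epsilon>)
      \<longleftrightarrow> (\<exists>\<^sub>F t in at_right 0. step_near \<Omega> v \<epsilon> (zbar, t))" for \<epsilon>
    by (rule frequently_cong[OF eventually_at_right_less])
       (auto simp: set_dist_rescaled_less_iff)
  then show ?thesis
    unfolding tangent_cone_def mem_PK_limsup_iff by simp
qed

text \<open>The tangent cone always lies between the other two: a property that holds eventually in
\<open>(z, t)\<close> holds in particular at \<open>z = zbar\<close> for small \<open>t\<close>, and steps from \<open>zbar\<close> are among
those that the paratingent cone allows.\<close>

lemma tangent_cone_eq_regular_tangent_cone:
  assumes "zbar \<in> \<Omega>" "strictly_smooth_at \<Omega> zbar"
  shows "tangent_cone \<Omega> zbar = regular_tangent_cone \<Omega> zbar"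
proof -
  have "v \<in> tangent_cone \<Omega> zbar" if v: "v \<in> regular_tangent_cone \<Omega> zbar" for v
    unfolding mem_tangent_cone_iff
  proof (intro allI impI)
    fix \<epsilon> :: real assume "\<epsilon> > 0"
    with v assms(1) obtain \<delta> where "\<delta> > 0"
      "\<forall>z\<in>\<Omega>. \<forall>t. dist z zbar < \<delta> \<and> 0 < t \<and> t < \<delta> \<longrightarrow> step_near \<Omega> v \<epsilon> (z, t)"
      unfolding mem_regular_tangent_cone_iff[OF assms(1)] eventually_base_filter by blast
    with assms(1) have "\<forall>\<^sub>F t in at_right 0. step_near \<Omega> v \<epsilon> (zbar, t)"
      by (auto simp: eventually_at_right_field)
    then show "\<exists>\<^sub>F t in at_right 0. step_near \<Omega> v \<epsilon> (zbar, t)"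
      by (intro eventually_frequently) auto
  qed
  moreover have "v \<in> paratingent_cone \<Omega> zbar" if v: "v \<in> tangent_cone \<Omega> zbar" for v
    unfolding mem_paratingent_cone_iff frequently_base_filter
  proof (intro allI impI)
    fix \<epsilon> \<delta> :: real assume "\<epsilon> > 0" "\<delta> > 0"
    have "\<exists>\<^sub>F t in at_right 0. step_near \<Omega> v \<epsilon> (zbar, t)"
      using v \<open>\<epsilon> > 0\<close> unfolding mem_tangent_cone_iff by blast
    then have "\<exists>\<^sub>F t in at_right 0. (0 < t \<and> t < \<delta>) \<and> step_near \<Omega> v \<epsilon> (zbar, t)"
      by (rule frequently_rev_mp)
         (use \<open>\<delta> > 0\<close> in \<open>auto simp: eventually_at_right_field\<close>)
    then obtain t where "(0 < t \<and> t < \<delta>) \<and> step_near \<Omega> v \<epsilon> (zbar, t)"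
      by (auto dest: frequently_ex)
    then show "\<exists>z\<in>\<Omega>. \<exists>t. dist z zbar < \<delta> \<and> 0 < t \<and> t < \<delta> \<and> step_near \<Omega> v \<epsilon> (z, t)"
      using assms(1) \<open>\<delta> > 0\<close> by (intro bexI[of _ zbar] exI[of _ t]) auto
  qed
  ultimately show ?thesis using assms(2) unfolding strictly_smooth_at_def by auto
qed

section \<open>The tangent space\<close>

lemma regular_tangent_cone_zero:
  assumes "zbar \<in> \<Omega>"
  shows "0 \<in> regular_tangent_cone \<Omega> zbar"
  unfolding mem_regular_tangent_cone_iff[OF assms] eventually_base_filter step_near_def
  by (auto intro!: exI[of _ 1] bexI)

lemma regular_tangent_cone_scale:
  assumes "zbar \<in> \<Omega>" and v: "v \<in> regular_tangent_cone \<Omega> zbar" and "0 < c"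
  shows "c *\<^sub>R v \<in> regular_tangent_cone \<Omega> zbar"
  unfolding mem_regular_tangent_cone_iff[OF assms(1)] eventually_base_filter
proof (intro allI impI)
  fix \<epsilon> :: real assume "\<epsilon> > 0"
  then have "\<epsilon> / c > 0" using \<open>0 < c\<close> by simp
  then obtain \<delta> where "\<delta> > 0"
    and \<delta>: "\<And>z t. z \<in> \<Omega> \<Longrightarrow> dist z zbar < \<delta> \<Longrightarrow> 0 < t \<Longrightarrow> t < \<delta> \<Longrightarrow> step_near \<Omega> v (\<epsilon> / c) (z, t)"
    using v unfolding mem_regular_tangent_cone_iff[OF assms(1)] eventually_base_filter by meson
  have "step_near \<Omega> (c *\<^sub>R v) \<epsilon> (z, t)"
    if "z \<in> \<Omega>" "dist z zbar < min \<delta> (\<delta> / c)" "0 < t" "t < min \<delta> (\<delta> / c)" for z t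
    using \<delta>[of z "c * t"] that \<open>0 < c\<close>
    by (auto simp: step_near_def pos_less_divide_eq mult.commute)
  then show "\<exists>\<delta>>0. \<forall>z\<in>\<Omega>. \<forall>t. dist z zbar < \<delta> \<and> 0 < t \<and> t < \<delta> \<longrightarrow>
      step_near \<Omega> (c *\<^sub>R v) \<epsilon> (z, t)"
    using \<open>\<delta> > 0\<close> \<open>0 < c\<close> by (intro exI[of _ "min \<delta> (\<delta> / c)"]) auto
qed

lemma step_near_dist:
  assumes "norm (w - z - t *\<^sub>R v) < \<epsilon> * t" "0 \<le> t"
  shows "dist w z \<le> t * (norm v + \<epsilon>)"
proof -
  have "norm (w - z) \<le> norm (w - z - t *\<^sub>R v) + norm (t *\<^sub>R v)"
    using norm_triangle_ineq[of "w - z - t *\<^sub>R v" "t *\<^sub>R v"] by simp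
  then show ?thesis using assms by (simp add: dist_norm algebra_simps)
qed

text \<open>Approximate steps can be chained because the base point is free: a step along \<open>u\<close> from
\<open>z\<close> ends at a point of \<open>\<Omega>\<close> that is still close to \<open>zbar\<close>, and a step along \<open>v\<close> may start
there.\<close>

lemma regular_tangent_cone_add:
  assumes "zbar \<in> \<Omega>"
    and u: "u \<in> regular_tangent_cone \<Omega> zbar" and v: "v \<in> regular_tangent_cone \<Omega> zbar"
  shows "u + v \<in> regular_tangent_cone \<Omega> zbar"
  unfolding mem_regular_tangent_cone_iff[OF assms(1)] eventually_base_filter
proof (intro allI impI)
  fix \<epsilon> :: real assume "\<epsilon> > 0"
  then have e: "\<epsilon> / 2 > 0" by simp
  obtain \<alpha> where "\<alpha> > 0"
    and \<alpha>: "\<And>z t. z \<in> \<Omega> \<Longrightarrow> dist z zbar < \<alpha> \<Longrightarrow> 0 < t \<Longrightarrow> t < \<alpha> \<Longrightarrow> step_near \<Omega> u (\<epsilon> / 2) (z, t)"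
    using u e unfolding mem_regular_tangent_cone_iff[OF assms(1)] eventually_base_filter by meson
  obtain \<beta> where "\<beta> > 0"
    and \<beta>: "\<And>z t. z \<in> \<Omega> \<Longrightarrow> dist z zbar < \<beta> \<Longrightarrow> 0 < t \<Longrightarrow> t < \<beta> \<Longrightarrow> step_near \<Omega> v (\<epsilon> / 2) (z, t)"
    using v e unfolding mem_regular_tangent_cone_iff[OF assms(1)] eventually_base_filter by meson
  \<comment> \<open>A step along u of length parameter t moves the base point by less than M * t, so
    this choice of delta leaves room for the second step.\<close>
  define M where "M = 1 + norm u + \<epsilon> / 2"
  have M: "M \<ge> 1" using e by (simp add: M_def)
  define \<delta> where "\<delta> = min \<alpha> (\<beta> / (2 * M))"
  have "\<delta> > 0" using \<open>\<alpha> > 0\<close> \<open>\<beta> > 0\<close> M by (simp add: \<delta>_def)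
  have "step_near \<Omega> (u + v) \<epsilon> (z, t)" if "z \<in> \<Omega>" "dist z zbar < \<delta>" "0 < t" "t < \<delta>" for z t
  proof -
    have le: "\<delta> * M \<le> \<beta> / 2" "\<delta> \<le> \<delta> * M"
      using M \<open>\<delta> > 0\<close> by (auto simp: \<delta>_def field_simps min_def)
    have "step_near \<Omega> u (\<epsilon> / 2) (z, t)" using \<alpha>[of z t] that by (simp add: \<delta>_def)
    then obtain w where w: "w \<in> \<Omega>" "norm (w - z - t *\<^sub>R u) < \<epsilon> / 2 * t"
      unfolding step_near_def by blast
    have "dist w z \<le> t * (norm u + \<epsilon> / 2)" using step_near_dist[OF w(2)] that by simp
    also have "\<dots> < \<delta> * M"
      using that e by (intro mult_strict_mono) (auto simp: M_def add_nonneg_pos)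
    finally have "dist w zbar < \<beta>"
      using dist_triangle[of w zbar z] that le by linarith
    moreover have "t < \<beta>" using that le \<open>\<beta> > 0\<close> by linarith
    ultimately have "step_near \<Omega> v (\<epsilon> / 2) (w, t)" using \<beta>[of w t] w(1) that by simp
    then obtain x where x: "x \<in> \<Omega>" "norm (x - w - t *\<^sub>R v) < \<epsilon> / 2 * t"
      unfolding step_near_def by blast
    have "norm (x - z - t *\<^sub>R (u + v)) < \<epsilon> * t"
      using norm_triangle_ineq[of "w - z - t *\<^sub>R u" "x - w - t *\<^sub>R v"] w(2) x(2)
      by (simp add: algebra_simps)
    then show ?thesis using x(1) by (auto simp: step_near_def)
  qed
  then show "\<exists>\<delta>>0. \<forall>z\<in>\<Omega>. \<forall>t. dist z zbar < \<delta> \<and> 0 < t \<and> t < \<delta> \<longrightarrow>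
      step_near \<Omega> (u + v) \<epsilon> (z, t)"
    using \<open>\<delta> > 0\<close> by blast
qed

text \<open>Reversing a secant of \<open>\<Omega>\<close> gives another secant: the end of the step becomes its base point.\<close>

lemma paratingent_cone_uminus:
  assumes v: "v \<in> paratingent_cone \<Omega> zbar"
  shows "- v \<in> paratingent_cone \<Omega> zbar"
  unfolding mem_paratingent_cone_iff frequently_base_filter
proof (intro allI impI)
  fix \<epsilon> \<delta> :: real assume "\<epsilon> > 0" "\<delta> > 0"
  define M where "M = 1 + norm v + \<epsilon>"
  have M: "M \<ge> 1" using \<open>\<epsilon> > 0\<close> by (simp add: M_def)
  define \<gamma> where "\<gamma> = \<delta> / (2 * M)"
  have "\<gamma> > 0" using \<open>\<delta> > 0\<close> M by (simp add: \<gamma>_def)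
  then obtain z t where z: "z \<in> \<Omega>" "dist z zbar < \<gamma>" "0 < t" "t < \<gamma>" "step_near \<Omega> v \<epsilon> (z, t)"
    using v \<open>\<epsilon> > 0\<close> unfolding mem_paratingent_cone_iff frequently_base_filter by meson
  then obtain w where w: "w \<in> \<Omega>" "norm (w - z - t *\<^sub>R v) < \<epsilon> * t"
    by (auto simp: step_near_def)
  have le: "\<gamma> * M \<le> \<delta> / 2" "\<gamma> \<le> \<gamma> * M"
    using M \<open>\<gamma> > 0\<close> by (auto simp: \<gamma>_def field_simps)
  have "dist w z \<le> t * (norm v + \<epsilon>)" using step_near_dist[OF w(2)] z by simp
  also have "\<dots> < \<gamma> * M"
    using z \<open>\<epsilon> > 0\<close> by (intro mult_strict_mono) (auto simp: M_def add_nonneg_pos)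
  finally have "dist w zbar < \<delta>"
    using dist_triangle[of w zbar z] z le by linarith
  moreover have "t < \<delta>" using z le \<open>\<delta> > 0\<close> by linarith
  moreover have "norm (z - w - t *\<^sub>R (- v)) < \<epsilon> * t"
    using w(2) norm_minus_commute[of "w - z" "t *\<^sub>R v"] by (simp add: algebra_simps)
  ultimately show "\<exists>z\<in>\<Omega>. \<exists>t. dist z zbar < \<delta> \<and> 0 < t \<and> t < \<delta> \<and> step_near \<Omega> (- v) \<epsilon> (z, t)"
    using w(1) z by (intro bexI[of _ w] exI[of _ t]) (auto simp: step_near_def)
qed

text \<open>The regular cone is convex and the paratingent cone symmetric; a cone with both properties is
a subspace.\<close>

lemma subspace_regular_tangent_cone:
  assumes "zbar \<in> \<Omega>" "strictly_smooth_at \<Omega> zbar"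
  shows "subspace (regular_tangent_cone \<Omega> zbar)"
proof -
  have neg: "- v \<in> regular_tangent_cone \<Omega> zbar" if "v \<in> regular_tangent_cone \<Omega> zbar" for v
    using that assms(2) paratingent_cone_uminus unfolding strictly_smooth_at_def by auto
  have "c *\<^sub>R v \<in> regular_tangent_cone \<Omega> zbar" if v: "v \<in> regular_tangent_cone \<Omega> zbar" for c v
  proof -
    consider "c > 0" | "c = 0" | "- c > 0" by linarith
    then show ?thesis
    proof cases
      case 1 then show ?thesis using regular_tangent_cone_scale[OF assms(1) v] by simp
    next
      case 2 then show ?thesis using regular_tangent_cone_zero[OF assms(1)] by simp
    next
      case 3 then show ?thesis
        using neg[OF regular_tangent_cone_scale[OF assms(1) v, of "- c"]] by simp
    qed
  qed
  then show ?thesis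
    using regular_tangent_cone_zero[OF assms(1)] regular_tangent_cone_add[OF assms(1)]
    by (simp add: subspace_def)
qed

section \<open>Uniformity over compact sets of directions\<close>

text \<open>Finitely many of the balls on which the property holds cover the compact set, and finitely
many eventual properties hold simultaneously.\<close>

lemma eventually_ball_compact:
  fixes K :: "'a::metric_space set"
  assumes "compact K"
    and loc: "\<And>u. u \<in> K \<Longrightarrow> \<exists>e>0. \<forall>\<^sub>F x in F. \<forall>v\<in>ball u e. P v x"
  shows "\<forall>\<^sub>F x in F. \<forall>u\<in>K. P u x"
proof -
  obtain e where e: "\<And>u. u \<in> K \<Longrightarrow> e u > 0 \<and> (\<forall>\<^sub>F x in F. \<forall>v\<in>ball u (e u). P v x)"
    using loc by metis
  obtain C where C: "C \<subseteq> K" "finite C" "K \<subseteq> (\<Union>u\<in>C. ball u (e u))"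
    using compactE_image[OF assms(1), of K "\<lambda>u. ball u (e u)"] e by force
  have "\<forall>\<^sub>F x in F. \<forall>u\<in>C. \<forall>v\<in>ball u (e u). P v x"
    using C e by (intro eventually_ball_finite) auto
  then show ?thesis
    by (rule eventually_mono) (use C(3) in blast)
qed

text \<open>Perturbing the direction by less than \<open>\<epsilon> / 2\<close> perturbs a step of size \<open>t\<close> by less than
\<open>t * \<epsilon> / 2\<close>, so that one tolerance serves a whole ball of directions.\<close>

lemma regular_tangent_cone_uniform:
  assumes "zbar \<in> \<Omega>" "compact K" "K \<subseteq> regular_tangent_cone \<Omega> zbar" "\<epsilon> > 0"
  shows "\<forall>\<^sub>F x in base_filter \<Omega> zbar. \<forall>v\<in>K. step_near \<Omega> v \<epsilon> x"
proof (rule eventually_ball_compact[OF assms(2)])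
  fix u assume "u \<in> K"
  then have "eventually (step_near \<Omega> u (\<epsilon> / 2)) (base_filter \<Omega> zbar)"
    using assms(3,4) mem_regular_tangent_cone_iff[OF assms(1), of u] by auto
  with eventually_base_filter_pos
  have "\<forall>\<^sub>F x in base_filter \<Omega> zbar. \<forall>v\<in>ball u (\<epsilon> / 2). step_near \<Omega> v \<epsilon> x"
  proof eventually_elim
    case (elim x)
    obtain z t where x: "x = (z, t)" by force
    with elim obtain w where w: "t > 0" "w \<in> \<Omega>" "norm (w - z - t *\<^sub>R u) < \<epsilon> / 2 * t"
      by (auto simp: step_near_def)
    have "norm (w - z - t *\<^sub>R v) < \<epsilon> * t" if "v \<in> ball u (\<epsilon> / 2)" for v
    proof -
      have "norm (t *\<^sub>R (u - v)) < t * (\<epsilon> / 2)" using that w(1) by (simp add: dist_norm)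
      then show ?thesis
        using norm_triangle_ineq[of "w - z - t *\<^sub>R u" "t *\<^sub>R (u - v)"] w(3)
        by (simp add: algebra_simps)
    qed
    with w(2) show ?case unfolding step_near_def x by blast
  qed
  then show "\<exists>e>0. \<forall>\<^sub>F x in base_filter \<Omega> zbar. \<forall>v\<in>ball u e. step_near \<Omega> v \<epsilon> x"
    using assms(4) by (intro exI[of _ "\<epsilon> / 2"]) auto
qed

text \<open>The complement of the paratingent cone is uniform in the same way; only the exact step
\<open>z + t *\<^sub>R v\<close> has to be excluded here, since every short secant of \<open>\<Omega>\<close> has this form with a
unit vector \<open>v\<close>.\<close>

lemma paratingent_cone_avoid_compact:
  assumes "compact K" "K \<inter> paratingent_cone \<Omega> zbar = {}"
  shows "\<forall>\<^sub>F x in base_filter \<Omega> zbar. \<forall>v\<in>K. fst x + snd x *\<^sub>R v \<notin> \<Omega>"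
proof (rule eventually_ball_compact[OF assms(1)])
  fix u assume "u \<in> K"
  then obtain e where e: "e > 0" "\<forall>\<^sub>F x in base_filter \<Omega> zbar. \<not> step_near \<Omega> u e x"
    using assms(2) mem_paratingent_cone_iff[of u \<Omega> zbar] unfolding not_frequently[symmetric] by blast
  from eventually_base_filter_pos e(2)
  have "\<forall>\<^sub>F x in base_filter \<Omega> zbar. \<forall>v\<in>ball u e. fst x + snd x *\<^sub>R v \<notin> \<Omega>"
  proof eventually_elim
    case (elim x)
    obtain z t where x: "x = (z, t)" by force
    show ?case
    proof
      fix v assume v: "v \<in> ball u e"
      have "norm (z + t *\<^sub>R v - z - t *\<^sub>R u) = t * norm (v - u)"
        using elim(1) x by (simp flip: scaleR_diff_right)
      also have "\<dots> < e * t" using v elim(1) x by (simp add: dist_norm norm_minus_commute mult.commute)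
      finally show "fst x + snd x *\<^sub>R v \<notin> \<Omega>" using elim(2) x by (auto simp: step_near_def)
    qed
  qed
  then show "\<exists>e>0. \<forall>\<^sub>F x in base_filter \<Omega> zbar. \<forall>v\<in>ball u e. fst x + snd x *\<^sub>R v \<notin> \<Omega>"
    using e(1) by blast
qed

section \<open>From strict smoothness to a local graph\<close>

text \<open>Here \<open>\<sigma>\<close> lifts a vector to the tangent space, so that \<open>u - \<sigma> (\<pi> u)\<close> measures how far \<open>u\<close>
is from being tangent. The unit vectors for which this defect is at least
\<open>\<epsilon> * norm (\<pi> u)\<close> form a compact set. It contains no paratingent vector, since such a
vector has defect 0, hence projection 0, and is then itself 0. By compactness the direction
of no short secant near \<open>zbar\<close> lies in it.

With \<open>\<epsilon> = 1\<close> this makes \<open>\<pi>\<close> injective on \<open>\<Omega>\<close> near \<open>zbar\<close> with a Lipschitz inverse; with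
\<open>\<epsilon>\<close> arbitrary it is strict differentiability.\<close>

lemma secants_near_tangent_space:
  fixes \<pi> :: "'a::euclidean_space \<Rightarrow> 'b::euclidean_space" and \<sigma> :: "'b \<Rightarrow> 'a"
  assumes lin: "linear \<pi>" "linear \<sigma>"
    and inv: "\<And>u. u \<in> paratingent_cone \<Omega> zbar \<Longrightarrow> \<sigma> (\<pi> u) = u"
    and "\<epsilon> > 0"
  obtains \<delta> where "\<delta> > 0"
    "\<And>z w. z \<in> \<Omega> \<Longrightarrow> w \<in> \<Omega> \<Longrightarrow> dist z zbar < \<delta> \<Longrightarrow> dist w zbar < \<delta> \<Longrightarrow>
      norm ((w - z) - \<sigma> (\<pi> (w - z))) \<le> \<epsilon> * norm (\<pi> (w - z))"
proof -
  define K where "K = sphere 0 1 \<inter> {u. \<epsilon> * norm (\<pi> u) \<le> norm (u - \<sigma> (\<pi> u))}"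
  have cont: "continuous_on UNIV \<pi>" "continuous_on UNIV \<sigma>"
    using lin by (auto simp: linear_continuous_on linear_linear)
  have "continuous_on UNIV (\<lambda>u. \<sigma> (\<pi> u))"
    using continuous_on_compose[OF cont(1) continuous_on_subset[OF cont(2)]] by (simp add: o_def)
  then have "closed {u. \<epsilon> * norm (\<pi> u) \<le> norm (u - \<sigma> (\<pi> u))}"
    by (intro closed_Collect_le continuous_intros cont)
  then have "compact K" unfolding K_def by (intro compact_Int_closed) auto
  moreover have "K \<inter> paratingent_cone \<Omega> zbar = {}"
  proof -
    have False if "u \<in> K" "u \<in> paratingent_cone \<Omega> zbar" for u
    proof -
      have "\<epsilon> * norm (\<pi> u) \<le> 0" using that inv[of u] by (simp add: K_def)
      then have "\<pi> u = 0" using \<open>\<epsilon> > 0\<close> by (simp add: mult_le_0_iff)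
      then have "u = 0" using inv[OF that(2)] linear_0[OF lin(2)] by simp
      then show False using that(1) by (simp add: K_def)
    qed
    then show ?thesis by blast
  qed
  ultimately obtain \<delta> where \<delta>: "\<delta> > 0"
    "\<And>z t v. z \<in> \<Omega> \<Longrightarrow> dist z zbar < \<delta> \<Longrightarrow> 0 < t \<Longrightarrow> t < \<delta> \<Longrightarrow> v \<in> K \<Longrightarrow> z + t *\<^sub>R v \<notin> \<Omega>"
    using paratingent_cone_avoid_compact[of K \<Omega> zbar] unfolding eventually_base_filter by auto
  show ?thesis
  proof (rule that[of "\<delta> / 2"])
    fix z w assume zw: "z \<in> \<Omega>" "w \<in> \<Omega>" "dist z zbar < \<delta> / 2" "dist w zbar < \<delta> / 2"
    show "norm ((w - z) - \<sigma> (\<pi> (w - z))) \<le> \<epsilon> * norm (\<pi> (w - z))"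
    proof (cases "w = z")
      case True then show ?thesis by (simp add: linear_0[OF lin(1)] linear_0[OF lin(2)])
    next
      case False
      define t where "t = norm (w - z)"
      define u where "u = (w - z) /\<^sub>R t"
      have t: "t > 0" "t < \<delta>" and wz: "w - z = t *\<^sub>R u"
        using False zw dist_triangle2[of w z zbar] by (auto simp: t_def u_def dist_norm)
      have "z + t *\<^sub>R u \<in> \<Omega>" using zw(2) wz by (simp flip: wz)
      then have "u \<notin> K" using \<delta>(2)[of z t u] zw t \<open>\<delta> > 0\<close> by auto
      moreover have "norm u = 1" using False by (simp add: u_def t_def)
      ultimately have "norm (u - \<sigma> (\<pi> u)) \<le> \<epsilon> * norm (\<pi> u)" by (simp add: K_def)
      then have "t * norm (u - \<sigma> (\<pi> u)) \<le> t * (\<epsilon> * norm (\<pi> u))" using t by simp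
      moreover have "norm ((w - z) - \<sigma> (\<pi> (w - z))) = t * norm (u - \<sigma> (\<pi> u))"
        using t by (simp add: wz linear_scale lin flip: scaleR_diff_right)
      moreover have "norm (\<pi> (w - z)) = t * norm (\<pi> u)"
        using t by (simp add: wz linear_scale lin)
      ultimately show ?thesis by (simp add: mult.left_commute)
    qed
  qed (use \<delta>(1) in simp)
qed

text \<open>Every \<open>y\<close> near \<open>\<pi> zbar\<close> is attained: take a point \<open>z\<close> of \<open>\<Omega>\<close> in a small closed ball for
which \<open>\<pi> z\<close> is nearest to \<open>y\<close>. It exists because \<open>\<Omega>\<close> is locally closed. If \<open>\<pi> z\<close> were
not \<open>y\<close>, a short step from \<open>z\<close> along the lift of \<open>y - \<pi> z\<close> would reach a point of
\<open>\<Omega>\<close> with a nearer projection. This contradicts minimality as long as the step stays in the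
ball, which is where the secant estimate enters: \<open>\<pi> z\<close> is close to \<open>\<pi> zbar\<close>, so \<open>z\<close> is
close to \<open>zbar\<close>, in the interior of the ball. The step must be available at \<open>z\<close>, not only at
\<open>zbar\<close>, and in a direction that depends on \<open>z\<close>: hence the regular cone, and its uniformity.\<close>

lemma projection_open_at:
  fixes \<pi> :: "'a::euclidean_space \<Rightarrow> 'b::euclidean_space" and \<sigma> :: "'b \<Rightarrow> 'a"
  assumes zbar: "zbar \<in> \<Omega>" and closed: "locally_closed_at \<Omega> zbar"
    and lin: "linear \<pi>" "linear \<sigma>" and "subspace Y"
    and \<pi>_Y: "\<And>u. \<pi> u \<in> Y" and \<pi>_le: "\<And>u. norm (\<pi> u) \<le> norm u"
    and inv: "\<And>u. u \<in> paratingent_cone \<Omega> zbar \<Longrightarrow> \<sigma> (\<pi> u) = u"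
    and \<sigma>_Y: "\<And>y. y \<in> Y \<Longrightarrow> \<sigma> y \<in> regular_tangent_cone \<Omega> zbar"
    and \<pi>_\<sigma>: "\<And>y. y \<in> Y \<Longrightarrow> \<pi> (\<sigma> y) = y"
    and "\<eta> > 0"
  obtains r where "r > 0"
    "\<And>y. y \<in> Y \<Longrightarrow> dist y (\<pi> zbar) < r \<Longrightarrow> \<exists>z\<in>\<Omega>. dist z zbar < \<eta> \<and> \<pi> z = y"
proof -
  obtain N where N: "closed (\<Omega> \<inter> N)" "zbar \<in> interior N"
    using closed unfolding locally_closed_at_def by blast
  then obtain a where a: "a > 0" "cball zbar a \<subseteq> N"
    using mem_interior_cball by blast
  obtain M where M: "M > 0" "\<And>y. norm (\<sigma> y) \<le> M * norm y"
    using linear_bounded_pos[OF lin(2)] by blast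
  obtain b where b: "b > 0"
    "\<And>z w. z \<in> \<Omega> \<Longrightarrow> w \<in> \<Omega> \<Longrightarrow> dist z zbar < b \<Longrightarrow> dist w zbar < b \<Longrightarrow>
      norm ((w - z) - \<sigma> (\<pi> (w - z))) \<le> 1 * norm (\<pi> (w - z))"
    using secants_near_tangent_space[OF lin inv zero_less_one] by blast
  define K where "K = \<sigma> ` (sphere 0 1 \<inter> Y)"
  have "compact K" unfolding K_def
    using closed_subspace[OF \<open>subspace Y\<close>] lin(2)
    by (intro compact_continuous_image compact_Int_closed)
       (auto simp: linear_linear linear_continuous_on)
  moreover have "K \<subseteq> regular_tangent_cone \<Omega> zbar" using \<sigma>_Y by (auto simp: K_def)
  ultimately obtain c where c: "c > 0"
    "\<And>z t v. z \<in> \<Omega> \<Longrightarrow> dist z zbar < c \<Longrightarrow> 0 < t \<Longrightarrow> t < c \<Longrightarrow> v \<in> K \<Longrightarrow> step_near \<Omega> v (1/2) (z, t)"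
    using regular_tangent_cone_uniform[OF zbar, of K "1/2"] unfolding eventually_base_filter
    by auto
  define \<rho> where "\<rho> = min (min a \<eta>) (min b c) / 2"
  have \<rho>: "\<rho> > 0" "\<rho> < a" "\<rho> < \<eta>" "\<rho> < b" "\<rho> < c"
    using a(1) b(1) c(1) \<open>\<eta> > 0\<close> by (auto simp: \<rho>_def)
  \<comment> \<open>M + 1 is a Lipschitz constant of the local inverse of the projection; the minimiser
    projects to within 2 * r of the projection of zbar.\<close>
  define r where "r = \<rho> / (2 * (M + 1))"
  have r: "r > 0" "(M + 1) * (2 * r) = \<rho>" using \<rho>(1) M(1) by (auto simp: r_def field_simps)
  have "\<exists>z\<in>\<Omega>. dist z zbar < \<eta> \<and> \<pi> z = y" if y: "y \<in> Y" "dist y (\<pi> zbar) < r" for y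
  proof -
    let ?C = "\<Omega> \<inter> N \<inter> cball zbar \<rho>"
    have "compact ?C" using N(1) by (intro closed_Int_compact) auto
    moreover have "zbar \<in> ?C" using zbar N(2) \<rho>(1) interior_subset by auto
    moreover have "continuous_on ?C (\<lambda>z. norm (\<pi> z - y))"
      using lin(1) by (intro continuous_intros linear_continuous_on) (simp add: linear_linear)
    ultimately obtain z where z: "z \<in> ?C" "\<And>w. w \<in> ?C \<Longrightarrow> norm (\<pi> z - y) \<le> norm (\<pi> w - y)"
      using continuous_attains_inf[of ?C "\<lambda>z. norm (\<pi> z - y)"] by blast
    have z\<Omega>: "z \<in> \<Omega>" "dist z zbar \<le> \<rho>" using z(1) by (auto simp: dist_commute)
    define s where "s = norm (\<pi> z - y)"
    have s_less: "s < r"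
      using z(2)[OF \<open>zbar \<in> ?C\<close>] y(2) by (simp add: s_def dist_norm norm_minus_commute)
    have "norm (z - zbar) < \<rho>"
    proof -
      let ?u = "z - zbar"
      have "norm (?u - \<sigma> (\<pi> ?u)) \<le> norm (\<pi> ?u)"
        using b(2)[OF zbar z\<Omega>(1)] z\<Omega>(2) \<rho> b(1) by auto
      then have "norm ?u \<le> norm (\<pi> ?u) + M * norm (\<pi> ?u)"
        using M(2)[of "\<pi> ?u"] norm_triangle_sub[of ?u "\<sigma> (\<pi> ?u)"] by linarith
      also have "\<dots> = (M + 1) * norm (\<pi> ?u)" by (simp add: algebra_simps)
      also have "\<dots> < (M + 1) * (2 * r)"
      proof (rule mult_strict_left_mono)
        have "norm (\<pi> ?u) \<le> s + norm (y - \<pi> zbar)"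
          using norm_triangle_ineq[of "\<pi> z - y" "y - \<pi> zbar"]
          by (simp add: s_def linear_diff[OF lin(1)])
        then show "norm (\<pi> ?u) < 2 * r" using s_less y(2) by (simp add: dist_norm)
      qed (use M(1) in simp)
      finally show ?thesis using r(2) by simp
    qed
    have "s = 0"
    proof (rule ccontr)
      assume "s \<noteq> 0"
      then have "s > 0" by (simp add: s_def)
      define e where "e = (y - \<pi> z) /\<^sub>R s"
      have e: "norm e = 1" "e \<in> Y" "\<pi> z - y = - s *\<^sub>R e"
        using \<open>s > 0\<close> y(1) \<pi>_Y \<open>subspace Y\<close>
        by (auto simp: e_def s_def norm_minus_commute subspace_diff subspace_scale)
      \<comment> \<open>The step is shorter than the remaining gap s, so it does not overshoot, and short enough
        to end in the ball of radius rho.\<close>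
      define t where
        "t = min (min s c / 2) ((\<rho> - norm (z - zbar)) / (norm (\<sigma> e) + 1/2))"
      have den: "norm (\<sigma> e) + 1/2 > 0" by (rule add_nonneg_pos) auto
      have t: "0 < t" "t \<le> s" "t < c"
        using \<open>s > 0\<close> c(1) den \<open>norm (z - zbar) < \<rho>\<close> by (auto simp: t_def)
      have "t \<le> (\<rho> - norm (z - zbar)) / (norm (\<sigma> e) + 1/2)" by (simp add: t_def)
      then have t': "t * (norm (\<sigma> e) + 1/2) \<le> \<rho> - norm (z - zbar)"
        using den by (simp only: pos_le_divide_eq)
      have "\<sigma> e \<in> K" using e by (auto simp: K_def)
      then obtain w where w: "w \<in> \<Omega>" "norm (w - z - t *\<^sub>R \<sigma> e) < 1/2 * t"
        using c(2)[of z t "\<sigma> e"] z\<Omega> \<rho> t unfolding step_near_def by auto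
      have "dist w z \<le> t * (norm (\<sigma> e) + 1/2)" using step_near_dist[OF w(2)] t by simp
      then have "dist w zbar \<le> \<rho>" using t' dist_triangle[of w zbar z] by (simp add: dist_norm)
      then have "w \<in> ?C" using w(1) a(2) \<rho>(2) by (auto simp: dist_commute subset_iff)
      then have "s \<le> norm (\<pi> w - y)" using z(2) s_def by simp
      also have "\<pi> w - y = \<pi> (w - z - t *\<^sub>R \<sigma> e) + (t - s) *\<^sub>R e"
      proof -
        have "\<pi> (w - z - t *\<^sub>R \<sigma> e) = \<pi> w - \<pi> z - t *\<^sub>R e"
          by (simp add: linear_diff linear_scale lin \<pi>_\<sigma>[OF e(2)])
        then have "\<pi> (w - z - t *\<^sub>R \<sigma> e) + (t - s) *\<^sub>R e = \<pi> w - \<pi> z - s *\<^sub>R e"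
          by (simp add: scaleR_diff_left)
        also have "\<dots> = \<pi> w - \<pi> z + (\<pi> z - y)" unfolding e(3) by simp
        finally show ?thesis by simp
      qed
      also have "norm \<dots> \<le> norm (w - z - t *\<^sub>R \<sigma> e) + (s - t)"
        using norm_triangle_ineq[of "\<pi> (w - z - t *\<^sub>R \<sigma> e)" "(t - s) *\<^sub>R e"]
          \<pi>_le[of "w - z - t *\<^sub>R \<sigma> e"] e(1) t(2) by simp
      also have "\<dots> < s" using w(2) t(1) by simp
      finally show False by simp
    qed
    then show ?thesis using z\<Omega> \<rho> by (intro bexI[of _ z]) (auto simp: s_def)
  qed
  with r(1) show ?thesis using that by blast
qed

text \<open>The local inverse \<open>h\<close> of \<open>\<pi>\<close> on \<open>\<Omega>\<close> yields the graph of \<open>f = \<psi> \<circ> h\<close>. The bound on \<open>norm u\<close>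
by its two components puts the product neighbourhood inside the ball where \<open>\<pi>\<close> is injective
on \<open>\<Omega>\<close>. The derivative at \<open>\<pi> zbar\<close> is \<open>\<psi> \<circ> \<sigma>\<close>, whose graph over \<open>Y\<close> is the tangent
space: the error of \<open>f\<close> along \<open>y' - y\<close> is the \<open>\<psi>\<close>-component of the defect of the secant
from \<open>h y\<close> to \<open>h y'\<close>.\<close>

lemma local_graph:
  fixes \<pi> \<psi> :: "'a::euclidean_space \<Rightarrow> 'b::euclidean_space" and \<sigma> :: "'b \<Rightarrow> 'a"
  assumes zbar: "zbar \<in> \<Omega>" and closed: "locally_closed_at \<Omega> zbar"
    and lin: "linear \<pi>" "linear \<sigma>" "linear \<psi>" and "subspace Y"
    and \<pi>_Y: "\<And>u. \<pi> u \<in> Y" and \<psi>_X: "\<And>u. \<psi> u \<in> X"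
    and \<pi>_le: "\<And>u. norm (\<pi> u) \<le> norm u" and \<psi>_le: "\<And>u. norm (\<psi> u) \<le> norm u"
    and le: "\<And>u. norm u \<le> norm (\<pi> u) + norm (\<psi> u)"
    and inv: "\<And>u. u \<in> paratingent_cone \<Omega> zbar \<Longrightarrow> \<sigma> (\<pi> u) = u"
    and \<sigma>_Y: "\<And>y. y \<in> Y \<Longrightarrow> \<sigma> y \<in> regular_tangent_cone \<Omega> zbar"
    and \<pi>_\<sigma>: "\<And>y. y \<in> Y \<Longrightarrow> \<pi> (\<sigma> y) = y"
  obtains r s f L where "r > 0" "s > 0"
    "(\<lambda>z. (\<pi> z, \<psi> z)) ` \<Omega> \<inter> (Y \<inter> ball (\<pi> zbar) r) \<times> (X \<inter> ball (\<psi> zbar) s)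
      = graph_on (Y \<inter> ball (\<pi> zbar) r) f"
    "L-lipschitz_on (Y \<inter> ball (\<pi> zbar) r) f"
    "\<And>\<epsilon>. \<epsilon> > 0 \<Longrightarrow> \<exists>\<delta>>0. \<forall>y\<in>Y \<inter> ball (\<pi> zbar) r. \<forall>y'\<in>Y \<inter> ball (\<pi> zbar) r.
        dist y (\<pi> zbar) < \<delta> \<and> dist y' (\<pi> zbar) < \<delta> \<longrightarrow>
        norm (f y' - f y - \<psi> (\<sigma> (y' - y))) \<le> \<epsilon> * norm (y' - y)"
proof -
  obtain \<delta>1 where \<delta>1: "\<delta>1 > 0"
    "\<And>z w. z \<in> \<Omega> \<Longrightarrow> w \<in> \<Omega> \<Longrightarrow> dist z zbar < \<delta>1 \<Longrightarrow> dist w zbar < \<delta>1 \<Longrightarrow>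
      norm ((w - z) - \<sigma> (\<pi> (w - z))) \<le> 1 * norm (\<pi> (w - z))"
    using secants_near_tangent_space[OF lin(1,2) inv zero_less_one] by blast
  obtain M where M: "M > 0" "\<And>y. norm (\<sigma> y) \<le> M * norm y"
    using linear_bounded_pos[OF lin(2)] by blast
  have "\<delta>1 / 2 > 0" using \<delta>1(1) by simp
  then obtain r0 where r0: "r0 > 0"
    "\<And>y. y \<in> Y \<Longrightarrow> dist y (\<pi> zbar) < r0 \<Longrightarrow> \<exists>z\<in>\<Omega>. dist z zbar < \<delta>1 / 2 \<and> \<pi> z = y"
    using projection_open_at[OF zbar closed lin(1,2) \<open>subspace Y\<close> \<pi>_Y \<pi>_le inv \<sigma>_Y \<pi>_\<sigma>] by metis
  define r where "r = min r0 (\<delta>1 / 2)"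
  have r: "r > 0" "r \<le> r0" "r \<le> \<delta>1 / 2" using r0(1) \<delta>1(1) by (auto simp: r_def)
  let ?V = "Y \<inter> ball (\<pi> zbar) r" and ?U = "X \<inter> ball (\<psi> zbar) (\<delta>1 / 2)"
  obtain h where h: "\<And>y. y \<in> ?V \<Longrightarrow> h y \<in> \<Omega> \<and> dist (h y) zbar < \<delta>1 / 2 \<and> \<pi> (h y) = y"
    using r0(2) r(2) by (metis IntE dist_commute mem_ball order_less_le_trans)
  have sec: "norm (w - z) \<le> (M + 1) * norm (\<pi> w - \<pi> z)"
    if "z \<in> \<Omega>" "w \<in> \<Omega>" "dist z zbar < \<delta>1" "dist w zbar < \<delta>1" for z w
  proof -
    have "norm (w - z) \<le> norm (\<pi> (w - z)) + M * norm (\<pi> (w - z))"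
      using \<delta>1(2)[OF that] M(2)[of "\<pi> (w - z)"] norm_triangle_sub[of "w - z" "\<sigma> (\<pi> (w - z))"]
      by linarith
    then show ?thesis by (simp add: algebra_simps linear_diff[OF lin(1)])
  qed
  define f where "f y = \<psi> (h y)" for y
  have near: "dist z zbar < \<delta>1" if "dist (\<pi> z) (\<pi> zbar) < r" "dist (\<psi> z) (\<psi> zbar) < \<delta>1 / 2" for z
    using le[of "z - zbar"] that r by (simp add: dist_norm linear_diff lin)
  have lip: "norm (h y' - h y) \<le> (M + 1) * norm (y' - y)" if "y \<in> ?V" "y' \<in> ?V" for y y'
    using sec[of "h y" "h y'"] h[OF that(1)] h[OF that(2)] \<delta>1(1) by auto
  have graph: "(\<lambda>z. (\<pi> z, \<psi> z)) ` \<Omega> \<inter> ?V \<times> ?U = graph_on ?V f"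
  proof -
    have "\<psi> z = f (\<pi> z)" if z: "z \<in> \<Omega>" "\<pi> z \<in> ?V" "\<psi> z \<in> ?U" for z
    proof -
      have "dist z zbar < \<delta>1" using near z by (auto simp: dist_commute)
      moreover have "dist (h (\<pi> z)) zbar < \<delta>1" using h[OF z(2)] \<delta>1(1) by linarith
      ultimately have "norm (z - h (\<pi> z)) \<le> 0"
        using sec[of "h (\<pi> z)" z] h[OF z(2)] z(1) by auto
      then show ?thesis by (simp add: f_def)
    qed
    moreover have "f y \<in> ?U" if "y \<in> ?V" for y
      using h[OF that] \<psi>_X \<psi>_le[of "zbar - h y"]
      by (auto simp: f_def dist_norm linear_diff[OF lin(3)] norm_minus_commute)
    moreover have "(y, f y) \<in> (\<lambda>z. (\<pi> z, \<psi> z)) ` \<Omega>" if "y \<in> ?V" for y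
      using h[OF that] by (auto simp: f_def intro!: image_eqI[of _ _ "h y"])
    ultimately show ?thesis unfolding graph_on_def by blast
  qed
  have "(M + 1)-lipschitz_on ?V f"
  proof (rule lipschitz_onI)
    fix x y assume "x \<in> ?V" "y \<in> ?V"
    then show "dist (f x) (f y) \<le> (M + 1) * dist x y"
      using lip[of y x] \<psi>_le[of "h x - h y"] by (simp add: f_def dist_norm linear_diff[OF lin(3)])
  qed (use M(1) in simp)
  moreover have "\<exists>\<delta>>0. \<forall>y\<in>?V. \<forall>y'\<in>?V. dist y (\<pi> zbar) < \<delta> \<and> dist y' (\<pi> zbar) < \<delta> \<longrightarrow>
        norm (f y' - f y - \<psi> (\<sigma> (y' - y))) \<le> \<epsilon> * norm (y' - y)" if "\<epsilon> > 0" for \<epsilon>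
  proof -
    obtain \<delta> where \<delta>: "\<delta> > 0"
      "\<And>z w. z \<in> \<Omega> \<Longrightarrow> w \<in> \<Omega> \<Longrightarrow> dist z zbar < \<delta> \<Longrightarrow> dist w zbar < \<delta> \<Longrightarrow>
        norm ((w - z) - \<sigma> (\<pi> (w - z))) \<le> \<epsilon> * norm (\<pi> (w - z))"
      using secants_near_tangent_space[OF lin(1,2) inv \<open>\<epsilon> > 0\<close>] by blast
    have near_h: "dist (h y) zbar < \<delta>" if "y \<in> ?V" "dist y (\<pi> zbar) < \<delta> / (M + 1)" for y
    proof -
      have "dist (h y) zbar \<le> (M + 1) * dist y (\<pi> zbar)"
        using sec[of zbar "h y"] zbar h[OF that(1)] \<delta>1(1) by (auto simp: dist_norm)
      also have "\<dots> < \<delta>" using that(2) M(1) by (simp add: pos_less_divide_eq mult.commute)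
      finally show ?thesis .
    qed
    have "norm (f y' - f y - \<psi> (\<sigma> (y' - y))) \<le> \<epsilon> * norm (y' - y)"
      if y: "y \<in> ?V" "y' \<in> ?V" "dist y (\<pi> zbar) < \<delta> / (M + 1)" "dist y' (\<pi> zbar) < \<delta> / (M + 1)"
      for y y'
    proof -
      have p: "\<pi> (h y' - h y) = y' - y" using h[OF y(1)] h[OF y(2)] by (simp add: linear_diff[OF lin(1)])
      have "f y' - f y - \<psi> (\<sigma> (y' - y)) = \<psi> ((h y' - h y) - \<sigma> (\<pi> (h y' - h y)))"
        unfolding p by (simp add: f_def linear_diff[OF lin(3)])
      also have "norm \<dots> \<le> norm ((h y' - h y) - \<sigma> (\<pi> (h y' - h y)))" by (rule \<psi>_le)
      also have "\<dots> \<le> \<epsilon> * norm (\<pi> (h y' - h y))"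
        using h[OF y(1)] h[OF y(2)] near_h y by (intro \<delta>(2)) auto
      finally show ?thesis unfolding p .
    qed
    then show ?thesis using \<delta>(1) M(1) by (intro exI[of _ "\<delta> / (M + 1)"]) auto
  qed
  ultimately show ?thesis using that[OF r(1) \<open>\<delta>1 / 2 > 0\<close> graph] by blast
qed

section \<open>Coordinates\<close>

lemma card_coord_rank_less:
  assumes "d \<le> CARD('n::{finite,linorder})"
  shows "card {i::'n. coord_rank i < d} = d"
proof -
  have less: "coord_rank i < coord_rank j" if "i < j" for i j :: 'n
    unfolding coord_rank_def using that by (intro psubset_card_mono) auto
  have "inj (coord_rank :: 'n \<Rightarrow> nat)"
    by (rule injI) (metis less less_irrefl neqE)
  moreover have "coord_rank i < CARD('n)" for i :: 'n
    unfolding coord_rank_def by (intro psubset_card_mono) auto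
  ultimately have "coord_rank ` (UNIV :: 'n set) = {..<CARD('n)}"
    by (intro card_subset_eq) (auto simp: card_image)
  then have "coord_rank ` {i::'n. coord_rank i < d} = {..<d}"
  proof safe
    fix k assume "k < d"
    then have "k \<in> range (coord_rank :: 'n \<Rightarrow> nat)"
      using assms \<open>range coord_rank = {..<CARD('n)}\<close> by simp
    then obtain i :: 'n where "k = coord_rank i" by blast
    with \<open>k < d\<close> show "k \<in> coord_rank ` {i::'n. coord_rank i < d}" by blast
  qed
  with \<open>inj coord_rank\<close> show ?thesis
    by (metis card_image card_lessThan inj_on_subset subset_UNIV)
qed

lemma subspace_first_space: "subspace (first_space d)"
  by (auto simp: subspace_def first_space_def)

lemma dim_first_space:
  assumes "d \<le> CARD('n::{finite,linorder})"
  shows "dim (first_space d :: 'n rvec set) = d"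
proof -
  have "first_space d = {v::'n rvec. \<forall>i. i \<notin> {i. coord_rank i < d} \<longrightarrow> v $ i = 0}"
    by (auto simp: first_space_def not_less)
  then show ?thesis
    using dim_substandard_cart[of "{i::'n. coord_rank i < d}", where 'a = real]
    by (simp only: dim_vec_eq card_coord_rank_less[OF assms])
qed

text \<open>A set \<open>I\<close> of coordinates of least size that determines the vectors of \<open>S\<close> is as large as
\<open>dim S\<close>: dropping \<open>i\<close> from \<open>I\<close> loses injectivity, so some vector of \<open>S\<close> vanishes at the other
coordinates in \<open>I\<close> but not at \<open>i\<close>. Hence the projection of \<open>S\<close> to the coordinates in \<open>I\<close>
contains all unit vectors and is onto as well as injective.\<close>

lemma subspace_determined_by_coordinates:
  fixes S :: "'n::finite rvec set"
  assumes "subspace S"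
  obtains I where "card I = dim S" "\<And>v. v \<in> S \<Longrightarrow> (\<And>i. i \<in> I \<Longrightarrow> v $ i = 0) \<Longrightarrow> v = 0"
proof -
  define D where "D I \<longleftrightarrow> (\<forall>v\<in>S. (\<forall>i\<in>I. v $ i = 0) \<longrightarrow> v = 0)" for I
  have "D UNIV" by (auto simp: D_def vec_eq_iff)
  then obtain I where I: "D I" and min: "\<And>J. D J \<Longrightarrow> card I \<le> card J"
    using ex_has_least_nat[of D UNIV card] by blast
  define c :: "'n rvec \<Rightarrow> 'n rvec" where "c v = (\<chi> i. if i \<in> I then v $ i else 0)" for v
  let ?E = "{x :: 'n rvec. \<forall>i. i \<notin> I \<longrightarrow> x $ i = 0}"
  have lin: "linear c" by (rule linearI) (auto simp: c_def vec_eq_iff)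
  have "inj_on c S"
    using I by (auto simp: linear_injective_on_subspace_0[OF lin assms] D_def c_def vec_eq_iff)
  then have "dim (c ` S) = dim S"
    using dim_image_eq[OF lin, of S] assms by (metis span_eq_iff)
  moreover have "c ` S = ?E"
  proof
    show "c ` S \<subseteq> ?E" by (auto simp: c_def)
    show "?E \<subseteq> c ` S"
    proof
      fix x assume "x \<in> ?E"
      have sub: "subspace (c ` S)" using linear_subspace_image[OF lin assms] .
      have ax: "axis i 1 \<in> c ` S" if "i \<in> I" for i
      proof -
        have "card (I - {i}) < card I" using that by (intro psubset_card_mono) auto
        then have "\<not> D (I - {i})" using min[of "I - {i}"] by auto
        then obtain v where v: "v \<in> S" "v \<noteq> 0" "\<forall>j\<in>I - {i}. v $ j = 0"
          by (auto simp: D_def)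
        then have "v $ i \<noteq> 0" using I by (auto simp: D_def)
        then have "c ((1 / v $ i) *\<^sub>R v) = axis i 1"
          using v(3) that by (auto simp: c_def vec_eq_iff axis_def)
        then show ?thesis using v(1) subspace_scale[OF assms] by (metis imageI)
      qed
      have "x = (\<Sum>i\<in>I. x $ i *\<^sub>R axis i 1)"
        using \<open>x \<in> ?E\<close> by (auto simp: vec_eq_iff axis_def if_distrib cong: if_cong)
      also have "\<dots> \<in> c ` S"
        by (intro subspace_sum[OF sub] subspace_scale[OF sub] ax)
      finally show "x \<in> c ` S" .
    qed
  qed
  ultimately have "card I = dim S"
    using dim_substandard_cart[of I, where 'a = real] by (simp add: dim_vec_eq)
  with I that show ?thesis unfolding D_def by blast
qed

lemma permutation_extending:
  fixes I J :: "'n::finite set"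
  assumes "card I = card J"
  obtains p where "p permutes UNIV" "p ` I = J"
proof -
  obtain f where f: "bij_betw f I J"
    using finite_same_card_bij[of I J] assms by auto
  have "card (- I) = card (- J)" using assms by (simp add: Compl_eq_Diff_UNIV card_Diff_subset)
  then obtain g where g: "bij_betw g (- I) (- J)"
    using finite_same_card_bij[of "- I" "- J"] by auto
  define p where "p i = (if i \<in> I then f i else g i)" for i
  have "bij_betw p I J" using f by (rule bij_betw_cong[THEN iffD1, rotated]) (simp add: p_def)
  moreover have "bij_betw p (- I) (- J)"
    using g by (rule bij_betw_cong[THEN iffD1, rotated]) (simp add: p_def)
  ultimately have "bij_betw p (I \<union> - I) (J \<union> - J)" by (rule bij_betw_combine) auto
  then have "p permutes UNIV" by (intro bij_imp_permutes) auto
  moreover have "p ` I = J" using \<open>bij_betw p I J\<close> by (simp add: bij_betw_def)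
  ultimately show ?thesis using that by blast
qed

text \<open>Agreement on the open set only, since \<^const>\<open>inv_into\<close> is arbitrary outside the image.\<close>

lemma C1_on_linear:
  fixes h :: "'a::euclidean_space \<Rightarrow> 'b::real_normed_vector"
  assumes "open W" "linear h" "\<And>x. x \<in> W \<Longrightarrow> f x = h x"
  shows "C1_on f W"
  unfolding C1_on_def
proof (intro exI[of _ "\<lambda>_. Blinfun h"] conjI ballI)
  have h: "bounded_linear h" using assms(2) by (simp add: linear_linear)
  show "(f has_derivative blinfun_apply (Blinfun h)) (at x)" if "x \<in> W" for x
    unfolding bounded_linear_Blinfun_apply[OF h]
    using bounded_linear_imp_has_derivative[OF h] assms(1) that
    by (rule has_derivative_transform_within_open) (simp add: assms(3))
qed simp

lemma strictly_differentiable_atI: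
  fixes A :: "('n::{finite,linorder} rvec, 'n) vec"
  assumes A: "\<And>i j. A $ i $ j \<noteq> 0 \<Longrightarrow> d \<le> coord_rank i \<and> coord_rank j < d"
    and near: "\<And>\<epsilon>. \<epsilon> > 0 \<Longrightarrow> \<exists>\<delta>>0. \<forall>y\<in>V. \<forall>y'\<in>V. dist y ybar < \<delta> \<and> dist y' ybar < \<delta> \<longrightarrow>
        norm (f y' - f y - A *v (y' - y)) \<le> \<epsilon> * norm (y' - y)"
  shows "strictly_differentiable_at d V f ybar"
  unfolding strictly_differentiable_at_def
proof (intro exI[of _ A] conjI allI impI)
  let ?q = "\<lambda>(y, y'). (f y' - f y - A *v (y' - y)) /\<^sub>R norm (y' - y)"
  show "(?q \<longlongrightarrow> 0) (at (ybar, ybar) within {(y, y'). y \<in> V \<and> y' \<in> V \<and> y \<noteq> y'})"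
    unfolding Lim_within
  proof (intro allI impI)
    fix e :: real assume "e > 0"
    then have "e / 2 > 0" by simp
    then obtain \<delta> where \<delta>: "\<delta> > 0"
      "\<And>y y'. y \<in> V \<Longrightarrow> y' \<in> V \<Longrightarrow> dist y ybar < \<delta> \<Longrightarrow> dist y' ybar < \<delta> \<Longrightarrow>
        norm (f y' - f y - A *v (y' - y)) \<le> e / 2 * norm (y' - y)"
      using near by blast
    have "dist (?q (y, y')) 0 < e"
      if "y \<in> V" "y' \<in> V" "y \<noteq> y'" "dist (y, y') (ybar, ybar) < \<delta>" for y y'
    proof -
      have "dist y ybar < \<delta>" "dist y' ybar < \<delta>"
        using that(4) dist_fst_le[of "(y, y')" "(ybar, ybar)"]
          dist_snd_le[of "(y, y')" "(ybar, ybar)"] by auto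
      then have "norm (f y' - f y - A *v (y' - y)) \<le> e / 2 * norm (y' - y)"
        using \<delta>(2) that by blast
      also have "\<dots> < e * norm (y' - y)" using that(3) \<open>e > 0\<close> by simp
      finally have "norm (f y' - f y - A *v (y' - y)) / norm (y' - y) < e"
        using that(3) by (simp add: pos_divide_less_eq)
      then show ?thesis by (simp add: divide_inverse mult.commute)
    qed
    then show "\<exists>d>0. \<forall>x\<in>{(y, y'). y \<in> V \<and> y' \<in> V \<and> y \<noteq> y'}.
        0 < dist x (ybar, ybar) \<and> dist x (ybar, ybar) < d \<longrightarrow> dist (?q x) 0 < e"
      using \<delta>(1) by (intro exI[of _ \<delta>]) auto
  qed
qed (use A in auto)

section \<open>Strictly smooth sets are graphs\<close>

theorem proposition3p1:
  fixes \<Omega> :: "('n::{finite,linorder}) rvec set" and zbar :: "'n rvec" and d :: nat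
  assumes "zbar \<in> \<Omega>"
    and "locally_closed_at \<Omega> zbar"
    and "strictly_smooth_at \<Omega> zbar"
    and "d = dim (tangent_cone \<Omega> zbar)"
  shows "subspace (tangent_cone \<Omega> zbar) \<and>
    lipschitz_manifold_around \<Omega> d zbar \<and>
    (\<exists>(Q :: ('n rvec, 'n) vec) (V :: 'n rvec set) (U :: 'n rvec set)
       (ybar :: 'n rvec) (xbar :: 'n rvec) (f :: 'n rvec \<Rightarrow> 'n rvec) L.
       permutation_matrix Q \<and>
       split_coords d (Q *v zbar) = (ybar, xbar) \<and>
       openin (top_of_set (first_space d)) V \<and>
       openin (top_of_set (last_space d)) U \<and>
       (ybar, xbar) \<in> V \<times> U \<and>
       f ` V \<subseteq> last_space d \<and>
       split_coords d ` ((\<lambda>z. Q *v z) ` \<Omega>) \<inter> V \<times> U = graph_on V f \<and>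
       L-lipschitz_on V f \<and>
       strictly_differentiable_at d V f ybar)"
proof -
  define S where "S = tangent_cone \<Omega> zbar"
  have S: "regular_tangent_cone \<Omega> zbar = S" "paratingent_cone \<Omega> zbar = S"
    using tangent_cone_eq_regular_tangent_cone[OF assms(1,3)] assms(3)
    by (auto simp: S_def strictly_smooth_at_def)
  have "subspace S" using subspace_regular_tangent_cone[OF assms(1,3)] S by simp
  have d: "d = dim S" "d \<le> CARD('n)"
    using assms(4) dim_subset_UNIV_cart[of S] by (simp_all add: S_def)
  \<comment> \<open>A permutation that moves coordinates determining the tangent space to the front.\<close>
  define R where "R = {i::'n. coord_rank i < d}"
  obtain I where I: "card I = dim S" "\<And>v. v \<in> S \<Longrightarrow> (\<And>i. i \<in> I \<Longrightarrow> v $ i = 0) \<Longrightarrow> v = 0"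
    using subspace_determined_by_coordinates[OF \<open>subspace S\<close>] by blast
  obtain p where p: "p permutes UNIV" "p ` R = I"
    using permutation_extending[of R I] card_coord_rank_less[OF d(2)] I(1) d(1)
    by (auto simp: R_def)
  define Q :: "('n rvec, 'n) vec" where "Q = (\<chi> i j. if j = p i then 1 else 0)"
  have Q: "Q *v z = (\<chi> i. z $ p i)" for z
    by (simp add: Q_def matrix_vector_mult_def if_distrib[where f = "\<lambda>a. a * _"] cong: if_cong)
  define \<pi> where "\<pi> z = fst (split_coords d (Q *v z))" for z
  define \<psi> where "\<psi> z = snd (split_coords d (Q *v z))" for z
  have \<pi>: "\<pi> z $ i = (if i \<in> R then z $ p i else 0)"
    and \<psi>: "\<psi> z $ i = (if i \<in> R then 0 else z $ p i)" for z i
    by (simp_all add: \<pi>_def \<psi>_def split_coords_def Q R_def)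
  have lin: "linear \<pi>" "linear \<psi>"
    by (auto intro!: linearI simp: vec_eq_iff \<pi> \<psi>)
  have "inj_on \<pi> S"
    unfolding linear_injective_on_subspace_0[OF lin(1) \<open>subspace S\<close>]
  proof (intro ballI impI)
    fix v assume v: "v \<in> S" "\<pi> v = 0"
    then have "v $ p i = 0" if "i \<in> R" for i using that \<pi>[of v i] by simp
    then show "v = 0" using I(2)[OF v(1)] p(2) by blast
  qed
  then obtain \<sigma> where \<sigma>: "range \<sigma> \<subseteq> S" "linear \<sigma>" "\<And>v. v \<in> S \<Longrightarrow> \<sigma> (\<pi> v) = v"
    using linear_exists_left_inverse_on[OF lin(1) \<open>subspace S\<close>] by blast
  have \<pi>_first: "\<pi> z \<in> first_space d" and \<psi>_last: "\<psi> z \<in> last_space d" for z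
    by (auto simp: first_space_def last_space_def \<pi> \<psi> R_def)
  have "\<pi> ` S = first_space d"
  proof (rule subspace_dim_equal)
    show "subspace (\<pi> ` S)" using linear_subspace_image[OF lin(1) \<open>subspace S\<close>] .
    have "dim (\<pi> ` S) = dim S"
      using dim_image_eq[OF lin(1), of S] \<open>inj_on \<pi> S\<close> \<open>subspace S\<close> by (metis span_eq_iff)
    then show "dim (first_space d :: 'n rvec set) \<le> dim (\<pi> ` S)"
      using dim_first_space[OF d(2)] d(1) by simp
  qed (use \<pi>_first subspace_first_space in auto)
  then have \<pi>_\<sigma>: "\<pi> (\<sigma> y) = y" if "y \<in> first_space d" for y
  proof -
    from that obtain v where "v \<in> S" "y = \<pi> v"
      unfolding \<open>\<pi> ` S = first_space d\<close>[symmetric] by (elim imageE)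
    then show ?thesis using \<sigma>(3) by simp
  qed
  have bij: "bij p" using p(1) by (rule permutes_bij)
  have norm_Q: "norm (Q *v z) = norm z" for z
    unfolding norm_vec_def L2_set_def Q
    using sum.reindex_bij_betw[OF bij, of "\<lambda>i. (norm (z $ i))\<^sup>2"] by simp
  have norm_\<pi>: "norm (\<pi> z) \<le> norm z" and norm_\<psi>: "norm (\<psi> z) \<le> norm z" for z
    unfolding norm_Q[of z, symmetric]
    by (auto intro!: norm_le_componentwise_cart simp: \<pi> \<psi> Q)
  have norm_le: "norm z \<le> norm (\<pi> z) + norm (\<psi> z)" for z
  proof -
    have "Q *v z = \<pi> z + \<psi> z" by (auto simp: vec_eq_iff \<pi> \<psi> Q)
    then show ?thesis unfolding norm_Q[of z, symmetric] by (simp add: norm_triangle_ineq)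
  qed
  have inv_para: "\<sigma> (\<pi> u) = u" if "u \<in> paratingent_cone \<Omega> zbar" for u
    using that \<sigma>(3) S(2) by simp
  have \<sigma>_regular: "\<sigma> y \<in> regular_tangent_cone \<Omega> zbar" for y
    using \<sigma>(1) S(1) by auto
  obtain r s f L where r: "r > 0" "s > 0"
    and graph: "(\<lambda>z. (\<pi> z, \<psi> z)) ` \<Omega> \<inter> (first_space d \<inter> ball (\<pi> zbar) r) \<times>
      (last_space d \<inter> ball (\<psi> zbar) s) = graph_on (first_space d \<inter> ball (\<pi> zbar) r) f"
    and lip: "L-lipschitz_on (first_space d \<inter> ball (\<pi> zbar) r) f"
    and diff: "\<And>\<epsilon>. \<epsilon> > 0 \<Longrightarrow> \<exists>\<delta>>0. \<forall>y\<in>first_space d \<inter> ball (\<pi> zbar) r.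
        \<forall>y'\<in>first_space d \<inter> ball (\<pi> zbar) r.
        dist y (\<pi> zbar) < \<delta> \<and> dist y' (\<pi> zbar) < \<delta> \<longrightarrow>
        norm (f y' - f y - \<psi> (\<sigma> (y' - y))) \<le> \<epsilon> * norm (y' - y)"
    by (rule local_graph[OF assms(1,2) lin(1) \<sigma>(2) lin(2) subspace_first_space[of d]
          \<pi>_first \<psi>_last norm_\<pi> norm_\<psi> norm_le inv_para \<sigma>_regular \<pi>_\<sigma>]) (assumption | rule that)+
  define V where "V = first_space d \<inter> ball (\<pi> zbar) r"
  define U where "U = last_space d \<inter> ball (\<psi> zbar) s"
  have split: "split_coords d (Q *v z) = (\<pi> z, \<psi> z)" for z by (simp add: \<pi>_def \<psi>_def)
  have graph': "split_coords d ` ((\<lambda>z. Q *v z) ` \<Omega>) \<inter> V \<times> U = graph_on V f"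
    using graph by (simp add: V_def U_def image_image split)
  have fV: "f ` V \<subseteq> last_space d"
  proof -
    have "graph_on V f \<subseteq> V \<times> U" using graph' by blast
    then show ?thesis by (auto simp: graph_on_def U_def)
  qed
  have V_open: "openin (top_of_set (first_space d)) V"
    and U_open: "openin (top_of_set (last_space d)) U"
    by (auto simp: V_def U_def openin_open_Int)
  have mem: "(\<pi> zbar, \<psi> zbar) \<in> V \<times> U"
    using r \<pi>_first \<psi>_last by (auto simp: V_def U_def)

  have "strictly_differentiable_at d V f (\<pi> zbar)"
  proof (rule strictly_differentiable_atI)
    \<comment> \<open>Truncating to d-space before applying sigma gives the matrix its zero columns; its zero rows
      come from psi.\<close>
    define c :: "'n rvec \<Rightarrow> 'n rvec" where "c y = (\<chi> i. if i \<in> R then y $ i else 0)" for y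
    have "linear c" by (rule linearI) (auto simp: c_def vec_eq_iff)
    then have linA: "linear (\<lambda>y. \<psi> (\<sigma> (c y)))"
      using linear_compose[OF linear_compose[OF _ \<sigma>(2)] lin(2), of c] by (simp add: o_def)
    let ?A = "matrix (\<lambda>y. \<psi> (\<sigma> (c y)))"
    show "d \<le> coord_rank i \<and> coord_rank j < d" if "?A $ i $ j \<noteq> 0" for i j
    proof -
      have nz: "\<psi> (\<sigma> (c (axis j 1))) $ i \<noteq> 0" using that by (simp add: matrix_def)
      then have "i \<notin> R" by (auto simp: \<psi>)
      moreover have "j \<in> R"
      proof (rule ccontr)
        assume "j \<notin> R"
        then have "c (axis j 1) = 0" by (auto simp: c_def vec_eq_iff axis_def)
        then show False using nz by (simp add: linear_0 \<sigma>(2) lin(2))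
      qed
      ultimately show ?thesis by (simp add: R_def not_less)
    qed
    have "?A *v (y' - y) = \<psi> (\<sigma> (y' - y))" if "y \<in> V" "y' \<in> V" for y y'
    proof -
      have "c (y' - y) = y' - y"
        using that by (auto simp: c_def vec_eq_iff V_def first_space_def R_def)
      then show ?thesis by (metis matrix_vector_mul(2)[OF linA])
    qed
    then show "\<exists>\<delta>>0. \<forall>y\<in>V. \<forall>y'\<in>V. dist y (\<pi> zbar) < \<delta> \<and> dist y' (\<pi> zbar) < \<delta> \<longrightarrow>
        norm (f y' - f y - ?A *v (y' - y)) \<le> \<epsilon> * norm (y' - y)" if "\<epsilon> > 0" for \<epsilon>
      using diff[OF that] by (simp add: V_def)
  qed
  moreover have "lipschitz_manifold_around \<Omega> d zbar"
  proof -
    \<comment> \<open>The chart is the permutation itself, restricted to the preimage of V and U.\<close>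
    define W where "W = {z. \<pi> z \<in> V \<and> \<psi> z \<in> U}"
    let ?\<Phi> = "\<lambda>z. Q *v z"
    define \<Phi>' :: "'n rvec \<Rightarrow> 'n rvec" where "\<Phi>' z = (\<chi> i. z $ inv p i)" for z
    have inv: "\<Phi>' (Q *v z) = z" "Q *v (\<Phi>' z) = z" for z
      using permutes_inverses[OF p(1)] by (simp_all add: Q \<Phi>'_def vec_eq_iff)
    have lin\<Phi>': "linear \<Phi>'" by (rule linearI) (auto simp: \<Phi>'_def vec_eq_iff)
    have "W = {z. dist (\<pi> zbar) (\<pi> z) < r} \<inter> {z. dist (\<psi> zbar) (\<psi> z) < s}"
      using \<pi>_first \<psi>_last by (auto simp: W_def V_def U_def)
    moreover have "open \<dots>"
      using lin by (intro open_Int open_Collect_less continuous_intros linear_continuous_on)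
        (auto simp: linear_linear)
    ultimately have "open W" by simp
    moreover have "zbar \<in> W" using mem by (simp add: W_def)
    moreover have "inj_on ?\<Phi> W" using inv(1) by (metis inj_on_inverseI)
    moreover have \<Phi>W: "open (?\<Phi> ` W)"
    proof -
      have "?\<Phi> ` W = \<Phi>' -` W" using inv by (auto simp: image_iff) metis
      then show ?thesis using \<open>open W\<close> lin\<Phi>'
        by (simp add: open_vimage linear_continuous_on linear_linear)
    qed
    moreover have "C1_on ?\<Phi> W" by (rule C1_on_linear[OF \<open>open W\<close>]) auto
    moreover have "C1_on (inv_into W ?\<Phi>) (?\<Phi> ` W)"
      using \<open>inj_on ?\<Phi> W\<close> inv(1) by (intro C1_on_linear[OF \<Phi>W lin\<Phi>']) auto
    moreover have "split_coords d ` (?\<Phi> ` (\<Omega> \<inter> W)) = graph_on V f"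
      unfolding graph'[symmetric] by (auto simp: W_def split)
    ultimately show ?thesis
      unfolding lipschitz_manifold_around_def
      using assms(1) d(2) V_open fV lip unfolding V_def[symmetric] by blast
  qed
  moreover have "permutation_matrix Q" using p(1) by (auto simp: permutation_matrix_def Q_def)
  ultimately show ?thesis
    using \<open>subspace S\<close> split[of zbar] V_open U_open mem fV graph' lip
    unfolding V_def[symmetric] S_def by blast
qed

end
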